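(* Let $G=(S,\mathit{Tr},\mathrm{src},\mathrm{tgt},S_0)$ be a transition system with a function $\mathrm{comp}:\mathit{Tr}\to\mathcal{P}(\mathcal{C})$, $\mathrm{comp}(t)\neq\emptyset$ for all $t$, and a collection $\mathcal{E}$ of events (subsets of $\mathit{Tr}$) such that: (a) $\mathcal{E}$ is a partition of $\mathit{Tr}$; (b) if an event $e$ is enabled in two states $s$ and $s'$ on a path $\pi$, then $e$ is enabled in each state and during each transition occurring on $\pi$ between $s$ and $s'$; (c) if $t\smile u$, $\mathrm{src}(t)=\mathrm{src}(u)$ and $t\in e$, then there is $v\in e$ with $\mathrm{src}(v)=\mathrm{tgt}(u)$; (d) if $t,t'\in e$ then $\mathrm{comp}(t)=\mathrm{comp}(t')$. Then a path of $G$ is just if and only if it is J-fair w.r.t. the task collection $\mathcal{E}$.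
   Context: A transition system is $G=(S,\mathit{Tr},\mathrm{src},\mathrm{tgt},S_0)$ with states, transitions, $\mathrm{src},\mathrm{tgt}:\mathit{Tr}\to S$, initial states. A path is an alternating sequence $s_0t_1s_1t_2\cdots$ of states and transitions, starting with a state, infinite or ending with a state, with $\mathrm{src}(t_i)=s_{i-1}$, $\mathrm{tgt}(t_i)=s_i$. A suffix of $s_0t_1s_1\cdots$ is $s_kt_{k+1}s_{k+1}\cdots$. Write $t\smile u$ iff $\mathrm{comp}(t)\cap\mathrm{comp}(u)=\emptyset$. For a task (here: event) $T\subseteq\mathit{Tr}$: $T$ is enabled in state $s$ if some $t\in T$ has $\mathrm{src}(t)=s$; enabled during a transition $u$ if there is $t\in T$ with $\mathrm{src}(t)=\mathrm{src}(u)$ and $t\smile u$; continuously enabled on $\pi$ if enabled in every state and during every transition of $\pi$; occurs in $\pi$ if $\pi$ contains a transition of $T$. A path $\pi$ is J-fair w.r.t. a task collection if for every suffix $\pi'$ each task continuously enabled on $\pi'$ occurs in $\pi'$. A path $\pi=s_0t_1s_1\cdots$ is just if for every position $i$ and every transition $t$ with $\mathrm{src}(t)=s_i$ there is $j>i$ with $\mathrm{comp}(t)\cap\mathrm{comp}(t_j)\neq\emptyset$. *)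

theory Defs
  imports Main "HOL-Library.Extended_Nat" "HOL-Library.FuncSet" "HOL-Library.Disjoint_Sets"
begin

record ('s, 't) trans_sys =
  states :: "'s set"
  transitions :: "'t set"
  src :: "'t \<Rightarrow> 's"
  tgt :: "'t \<Rightarrow> 's"
  initials :: "'s set"

locale transition_system =
  fixes G :: "('s, 't) trans_sys"
  assumes src_closed: "src G \<in> transitions G \<rightarrow> states G"
    and tgt_closed: "tgt G \<in> transitions G \<rightarrow> states G"
    and initials_subset: "initials G \<subseteq> states G"

text \<open>
  An alternating sequence $s_0 t_1 s_1 t_2 \ldots$ is given by the number of its transitions
  (\<open>\<infinity>\<close> for an infinite sequence), with \<open>state_at \<pi> i\<close> for $s_i$ and \<open>trans_at \<pi> i\<close> for $t_i$.
  Transitions are numbered from 1; \<open>trans_at \<pi> 0\<close> and all values at indices beyond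
  \<open>len \<pi>\<close> are irrelevant. A sequence may start in any state, not just an initial one.
\<close>
record ('s, 't) alt_seq =
  len :: enat
  state_at :: "nat \<Rightarrow> 's"
  trans_at :: "nat \<Rightarrow> 't"

definition states_of :: "('s, 't) alt_seq \<Rightarrow> 's set" where
  "states_of \<pi> = {state_at \<pi> i | i. enat i \<le> len \<pi>}"

definition transitions_of :: "('s, 't) alt_seq \<Rightarrow> 't set" where
  "transitions_of \<pi> = {trans_at \<pi> i | i. 1 \<le> i \<and> enat i \<le> len \<pi>}"

definition is_path :: "('s, 't) trans_sys \<Rightarrow> ('s, 't) alt_seq \<Rightarrow> bool" where
  "is_path G \<pi> \<longleftrightarrow>
     states_of \<pi> \<subseteq> states G \<and> transitions_of \<pi> \<subseteq> transitions G \<and>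
     (\<forall>i. 1 \<le> i \<and> enat i \<le> len \<pi> \<longrightarrow>
        src G (trans_at \<pi> i) = state_at \<pi> (i - 1) \<and> tgt G (trans_at \<pi> i) = state_at \<pi> i)"

definition suffix_from :: "nat \<Rightarrow> ('s, 't) alt_seq \<Rightarrow> ('s, 't) alt_seq" where
  "suffix_from k \<pi> =
     \<lparr>len = len \<pi> - enat k,
      state_at = (\<lambda>i. state_at \<pi> (k + i)),
      trans_at = (\<lambda>i. trans_at \<pi> (k + i))\<rparr>"

definition suffixes_of :: "('s, 't) alt_seq \<Rightarrow> ('s, 't) alt_seq set" where
  "suffixes_of \<pi> = {suffix_from k \<pi> | k. enat k \<le> len \<pi>}"

definition concurrent :: "('t \<Rightarrow> 'c set) \<Rightarrow> 't \<Rightarrow> 't \<Rightarrow> bool" where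
  "concurrent comps t u \<longleftrightarrow> comps t \<inter> comps u = {}"

definition enabled_in :: "('s, 't) trans_sys \<Rightarrow> 't set \<Rightarrow> 's \<Rightarrow> bool" where
  "enabled_in G T s \<longleftrightarrow> (\<exists>t\<in>T. src G t = s)"

definition enabled_during ::
    "('s, 't) trans_sys \<Rightarrow> ('t \<Rightarrow> 'c set) \<Rightarrow> 't set \<Rightarrow> 't \<Rightarrow> bool" where
  "enabled_during G comps T u \<longleftrightarrow> (\<exists>t\<in>T. src G t = src G u \<and> concurrent comps t u)"

definition continuously_enabled ::
    "('s, 't) trans_sys \<Rightarrow> ('t \<Rightarrow> 'c set) \<Rightarrow> 't set \<Rightarrow> ('s, 't) alt_seq \<Rightarrow> bool" where
  "continuously_enabled G comps T \<pi> \<longleftrightarrow>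
     (\<forall>s\<in>states_of \<pi>. enabled_in G T s) \<and>
     (\<forall>u\<in>transitions_of \<pi>. enabled_during G comps T u)"

definition occurs_in :: "'t set \<Rightarrow> ('s, 't) alt_seq \<Rightarrow> bool" where
  "occurs_in T \<pi> \<longleftrightarrow> transitions_of \<pi> \<inter> T \<noteq> {}"

definition J_fair ::
    "('s, 't) trans_sys \<Rightarrow> ('t \<Rightarrow> 'c set) \<Rightarrow> 't set set \<Rightarrow> ('s, 't) alt_seq \<Rightarrow> bool" where
  "J_fair G comps \<T> \<pi> \<longleftrightarrow>
     (\<forall>\<pi>'\<in>suffixes_of \<pi>. \<forall>T\<in>\<T>. continuously_enabled G comps T \<pi>' \<longrightarrow> occurs_in T \<pi>')"

definition just :: "('s, 't) trans_sys \<Rightarrow> ('t \<Rightarrow> 'c set) \<Rightarrow> ('s, 't) alt_seq \<Rightarrow> bool" where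
  "just G comps \<pi> \<longleftrightarrow>
     (\<forall>i t. enat i \<le> len \<pi> \<and> t \<in> transitions G \<and> src G t = state_at \<pi> i \<longrightarrow>
        (\<exists>j>i. enat j \<le> len \<pi> \<and> comps t \<inter> comps (trans_at \<pi> j) \<noteq> {}))"

end

theory Submission
  imports Defs
begin

text \<open>
  Events have constant, nonempty component sets, so an event that occurs interferes with each of
  its own members. On a just path an enabled transition of an event is eventually interfered with,
  so no event is continuously enabled on a suffix. Conversely, if a transition of an event is never
  interfered with, condition (c) propagates enabledness of the event along the rest of the path,
  so by J-fairness the event occurs, which is an interference after all.
\<close>

text \<open>The assumption excludes truncation: subtraction on \<open>enat\<close> stops at 0, so
  for \<open>n < enat k\<close> the case \<open>i = 0\<close> would break the equivalence.\<close>

lemma le_len_minus_iff: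
  fixes n :: enat
  assumes "enat k \<le> n"
  shows "enat i \<le> n - enat k \<longleftrightarrow> enat (k + i) \<le> n"
  using assms by (cases n) auto

lemma states_of_suffix_from:
  assumes "enat k \<le> len \<pi>"
  shows "states_of (suffix_from k \<pi>) = {state_at \<pi> j | j. k \<le> j \<and> enat j \<le> len \<pi>}"
  using le_len_minus_iff[OF assms]
  by (auto simp: states_of_def suffix_from_def) (metis le_Suc_ex)

text \<open>The bound \<open>k < j\<close> is strict because the transition at position
  \<open>k\<close> leads into the first state of the suffix and so lies before it.\<close>

lemma transitions_of_suffix_from:
  assumes "enat k \<le> len \<pi>"
  shows "transitions_of (suffix_from k \<pi>) = {trans_at \<pi> j | j. k < j \<and> enat j \<le> len \<pi>}"
proof -
  have "\<exists>i. trans_at \<pi> j = trans_at \<pi> (k + i) \<and> Suc 0 \<le> i \<and> enat (k + i) \<le> len \<pi>"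
    if "k < j" "enat j \<le> len \<pi>" for j
    using that by (intro exI[of _ "j - k"]) auto
  moreover have "\<exists>j. trans_at \<pi> (k + i) = trans_at \<pi> j \<and> k < j \<and> enat j \<le> len \<pi>"
    if "Suc 0 \<le> i" "enat (k + i) \<le> len \<pi>" for i
    using that by (intro exI[of _ "k + i"]) auto
  ultimately show ?thesis
    by (auto simp: transitions_of_def suffix_from_def le_len_minus_iff[OF assms])
qed

text \<open>Moves continuous enabledness to positions of \<open>\<pi>\<close> itself, the indexing
  in which \<open>just\<close> is phrased.\<close>

lemma continuously_enabled_suffix_from_iff:
  assumes "enat k \<le> len \<pi>"
  shows "continuously_enabled G comps T (suffix_from k \<pi>) \<longleftrightarrow>
    (\<forall>j\<ge>k. enat j \<le> len \<pi> \<longrightarrow> enabled_in G T (state_at \<pi> j)) \<and>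
    (\<forall>j>k. enat j \<le> len \<pi> \<longrightarrow> enabled_during G comps T (trans_at \<pi> j))"
  unfolding continuously_enabled_def
    states_of_suffix_from[OF assms] transitions_of_suffix_from[OF assms]
  by blast

lemma just_imp_J_fair:
  assumes events: "\<And>e. e \<in> \<E> \<Longrightarrow> e \<subseteq> transitions G"
    and comps_eq: "\<And>e t t'. \<lbrakk>e \<in> \<E>; t \<in> e; t' \<in> e\<rbrakk> \<Longrightarrow> comps t = comps t'"
    and just: "just G comps \<pi>"
  shows "J_fair G comps \<E> \<pi>"
proof -
  \<comment> \<open>The implication in J-fairness holds vacuously: on a just path no event is
    continuously enabled on any suffix.\<close>
  have False
    if k: "enat k \<le> len \<pi>" and e: "e \<in> \<E>"
      and ce: "continuously_enabled G comps e (suffix_from k \<pi>)" for k e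
  proof -
    obtain t where t: "t \<in> e" "src G t = state_at \<pi> k"
      using ce k by (auto simp: continuously_enabled_suffix_from_iff enabled_in_def)
    then obtain j where j: "j > k" "enat j \<le> len \<pi>" "comps t \<inter> comps (trans_at \<pi> j) \<noteq> {}"
      using just k events[OF e] unfolding just_def by blast
    \<comment> \<open>The member of \<open>e\<close> witnessing enabledness during the interfering
      transition may differ from \<open>t\<close>, but \<open>comps_eq\<close> gives it the same
      components, so it cannot be concurrent with that transition.\<close>
    then obtain t' where "t' \<in> e" "comps t' \<inter> comps (trans_at \<pi> j) = {}"
      using ce
      unfolding continuously_enabled_suffix_from_iff[OF k] enabled_during_def concurrent_def
      by blast
    with j comps_eq[OF e t(1)] show False by blast
  qed
  then show ?thesis
    by (auto simp: J_fair_def suffixes_of_def)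
qed

text \<open>Induction along the path. The member of \<open>e\<close> that is enabled may change at
  every step, but each has the components of \<open>t\<close> and is thus concurrent with the next
  transition, so \<open>persist\<close> applies again.\<close>

lemma enabled_until_interference:
  assumes path: "is_path G \<pi>" and e: "e \<subseteq> transitions G" "t \<in> e"
    and persist: "\<And>t u. \<lbrakk>t \<in> e; u \<in> transitions G; concurrent comps t u; src G t = src G u\<rbrakk>
      \<Longrightarrow> \<exists>v\<in>e. src G v = tgt G u"
    and comps_eq: "\<And>t'. t' \<in> e \<Longrightarrow> comps t' = comps t"
    and start: "src G t = state_at \<pi> i"
    and no_interference:
      "\<And>j. \<lbrakk>i < j; enat j \<le> len \<pi>\<rbrakk> \<Longrightarrow> concurrent comps t (trans_at \<pi> j)"
    and "i \<le> j" "enat j \<le> len \<pi>"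
  shows "enabled_in G e (state_at \<pi> j)"
  using \<open>i \<le> j\<close> \<open>enat j \<le> len \<pi>\<close>
proof (induction j rule: dec_induct)
  case base
  then show ?case using e start by (auto simp: enabled_in_def)
next
  case (step j)
  let ?u = "trans_at \<pi> (Suc j)"
  have "enat j \<le> len \<pi>"
    using step.prems by (meson enat_ord_simps(1) le_SucI order_refl order_trans)
  then obtain v where v: "v \<in> e" "src G v = state_at \<pi> j"
    using step.IH by (auto simp: enabled_in_def)
  have u: "?u \<in> transitions G" "src G ?u = state_at \<pi> j" "tgt G ?u = state_at \<pi> (Suc j)"
    using path step.prems by (force simp: is_path_def transitions_of_def)+
  have "concurrent comps v ?u"
    using no_interference[of "Suc j"] step comps_eq[OF v(1)] by (simp add: concurrent_def)
  then show ?case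
    using persist[OF v(1) u(1)] v(2) u by (auto simp: enabled_in_def)
qed

lemma J_fair_imp_just:
  assumes path: "is_path G \<pi>"
    and nonempty: "\<And>t. t \<in> transitions G \<Longrightarrow> comps t \<noteq> {}"
    and events: "\<Union>\<E> = transitions G"
    and persist: "\<And>e t u. \<lbrakk>e \<in> \<E>; t \<in> transitions G; u \<in> transitions G;
      concurrent comps t u; src G t = src G u; t \<in> e\<rbrakk> \<Longrightarrow> \<exists>v\<in>e. src G v = tgt G u"
    and comps_eq: "\<And>e t t'. \<lbrakk>e \<in> \<E>; t \<in> e; t' \<in> e\<rbrakk> \<Longrightarrow> comps t = comps t'"
    and fair: "J_fair G comps \<E> \<pi>"
  shows "just G comps \<pi>"
  unfolding just_def
proof (intro allI impI, elim conjE, rule ccontr)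
  fix i t
  assume i: "enat i \<le> len \<pi>" and t: "t \<in> transitions G" "src G t = state_at \<pi> i"
    and "\<not> (\<exists>j>i. enat j \<le> len \<pi> \<and> comps t \<inter> comps (trans_at \<pi> j) \<noteq> {})"
  then have conc: "concurrent comps t (trans_at \<pi> j)" if "i < j" "enat j \<le> len \<pi>" for j
    using that by (auto simp: concurrent_def)
  \<comment> \<open>Since the events cover all transitions, J-fairness of some event can be brought
    to bear on the single transition \<open>t\<close>.\<close>
  obtain e where e: "e \<in> \<E>" "t \<in> e" using events t by blast
  then have sub: "e \<subseteq> transitions G" using events by blast
  have en: "enabled_in G e (state_at \<pi> j)" if "i \<le> j" "enat j \<le> len \<pi>" for j
    using enabled_until_interference[OF path sub e(2) _ _ t(2) conc that]
      persist[OF e(1)] comps_eq[OF e(1)] e(2) sub by blast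
  have "enabled_during G comps e (trans_at \<pi> j)" if j: "i < j" "enat j \<le> len \<pi>" for j
  proof -
    \<comment> \<open>The source of the transition at position \<open>j\<close> is the state at
      \<open>j - 1\<close>; as \<open>i < j\<close>, this is still at or after \<open>i\<close>,
      where \<open>en\<close> applies.\<close>
    have "enat (j - 1) \<le> len \<pi>"
      using j(2) by (meson diff_le_self enat_ord_simps(1) order_trans)
    then obtain v where v: "v \<in> e" "src G v = state_at \<pi> (j - 1)"
      using en[of "j - 1"] j(1) unfolding enabled_in_def by fastforce
    moreover have "src G (trans_at \<pi> j) = state_at \<pi> (j - 1)"
      using path j by (auto simp: is_path_def)
    moreover have "concurrent comps v (trans_at \<pi> j)"
      using conc[OF j] comps_eq[OF e v(1)] by (simp add: concurrent_def)
    ultimately show ?thesis by (auto simp: enabled_during_def)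
  qed
  with en have "continuously_enabled G comps e (suffix_from i \<pi>)"
    by (simp add: continuously_enabled_suffix_from_iff[OF i])
  then have "occurs_in e (suffix_from i \<pi>)"
    using fair e(1) i by (auto simp: J_fair_def suffixes_of_def)
  then obtain j where j: "i < j" "enat j \<le> len \<pi>" "trans_at \<pi> j \<in> e"
    by (auto simp: occurs_in_def transitions_of_suffix_from[OF i])
  \<comment> \<open>The occurring transition has the same components as \<open>t\<close>, so
    concurrency with it would make \<open>comps t\<close> disjoint from itself, hence empty.\<close>
  then show False
    using conc[OF j(1,2)] comps_eq[OF e j(3)] nonempty[OF t(1)] by (simp add: concurrent_def)
qed

theorem theorem15p1:
  fixes G :: "('s, 't) trans_sys"
    and C :: "'c set"
    and comps :: "'t \<Rightarrow> 'c set"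
    and \<E> :: "'t set set"
    and \<pi> :: "('s, 't) alt_seq"
  assumes "transition_system G"
    and "comps \<in> transitions G \<rightarrow> Pow C"
    and "\<And>t. t \<in> transitions G \<Longrightarrow> comps t \<noteq> {}"
    and "partition_on (transitions G) \<E>"
    and "\<And>e \<rho> i j. \<lbrakk>e \<in> \<E>; is_path G \<rho>; i \<le> j; enat j \<le> len \<rho>;
            enabled_in G e (state_at \<rho> i); enabled_in G e (state_at \<rho> j)\<rbrakk> \<Longrightarrow>
          (\<forall>k. i \<le> k \<and> k \<le> j \<longrightarrow> enabled_in G e (state_at \<rho> k)) \<and>
          (\<forall>k. i < k \<and> k \<le> j \<longrightarrow> enabled_during G comps e (trans_at \<rho> k))"
    and "\<And>e t u. \<lbrakk>e \<in> \<E>; t \<in> transitions G; u \<in> transitions G;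
            concurrent comps t u; src G t = src G u; t \<in> e\<rbrakk> \<Longrightarrow>
          \<exists>v\<in>e. src G v = tgt G u"
    and "\<And>e t t'. \<lbrakk>e \<in> \<E>; t \<in> e; t' \<in> e\<rbrakk> \<Longrightarrow> comps t = comps t'"
    and "is_path G \<pi>"
  shows "just G comps \<pi> \<longleftrightarrow> J_fair G comps \<E> \<pi>"
proof
  have events: "\<Union>\<E> = transitions G"
    using assms(4) by (simp add: partition_on_def)
  then have sub: "\<And>e. e \<in> \<E> \<Longrightarrow> e \<subseteq> transitions G"
    by blast
  show "J_fair G comps \<E> \<pi>" if "just G comps \<pi>"
    using just_imp_J_fair[OF sub assms(7) that] .
  show "just G comps \<pi>" if "J_fair G comps \<E> \<pi>"
    using J_fair_imp_just[OF assms(8,3) events assms(6,7) that] .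
qed

end
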